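(* If $f:G\to\mathbb{C}$ is an analytic and $\vee$-differentiable function defined on an open subset $G\subseteq\mathbb{C}$, then for all $z\in G$, $$D_\vee f(z)=f(z)+\log[f'(z)]-z,$$ where $D_\vee f$ is the $\vee$-derivative of $f$ and $f'$ is the ordinary complex derivative of $f$.
   Context: The element $-\infty$ is adjoined to $\mathbb{C}$, with the conventions $-\infty+w=-\infty$ and $-\infty\vee w=w$ for $w\in\mathbb{C}$, $e^{-\infty}=0$ and $\log(0)=-\infty$. The complex logarithm is the multivalued function $\log(w)=\ln|w|+i\arg(w)$, with the branch left unspecified; equations involving it are in many cases, strictly speaking, equivalences modulo $2\pi i$. The complex join is $z_1\vee z_2:=\log[\exp(z_1)+\exp(z_2)]$. The inverse of $z$ with respect to $\vee$ is $z+i\pi$. $\vee$-derivative: let $G\subseteq\mathbb{C}$ be open, $f:G\to\mathbb{C}\cup\{-\infty\}$, and suppose that for some $z\in\mathbb{C}\cup\{-\infty\}$ the limit $$\lim_{h\to-\infty}\big\{[f(z\vee h)\vee(f(z)+i\pi)]-h\big\}$$ exists and is finite. Then $f$ is called $\vee$-differentiable at $z$, and the limit is denoted $D_\vee f(z)$ and called the $\vee$-derivative of $f$ at $z$. *)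

theory Defs
  imports "HOL-Complex_Analysis.Complex_Analysis"
begin

datatype excomplex = MInf | Fin complex

fun shift :: "excomplex \<Rightarrow> complex \<Rightarrow> excomplex"  (infixl \<open>\<oplus>\<^sub>e\<close> 65) where
  "MInf \<oplus>\<^sub>e w = MInf"
| "Fin z \<oplus>\<^sub>e w = Fin (z + w)"

fun eexp :: "excomplex \<Rightarrow> complex" where
  "eexp MInf = 0"
| "eexp (Fin z) = exp z"

text \<open>A basic neighbourhood of \<open>-\<infinity>\<close> is \<open>-\<infinity>\<close> together with a half-plane \<open>Re z < r\<close>, so that
  \<open>h\<close> tends to \<open>-\<infinity>\<close> iff \<open>exp h\<close> tends to \<open>0\<close>; see \<open>at_minf_eq_exp\<close> below.\<close>

instantiation excomplex :: topological_space
begin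

definition open_excomplex :: "excomplex set \<Rightarrow> bool" where
  "open_excomplex U \<longleftrightarrow>
     open (Fin -` U) \<and> (MInf \<in> U \<longrightarrow> (\<exists>r. \<forall>z. Re z < r \<longrightarrow> Fin z \<in> U))"

instance
proof
  show "open (UNIV :: excomplex set)"
    by (simp add: open_excomplex_def)
next
  fix S T :: "excomplex set"
  assume S: "open S" and T: "open T"
  have "\<exists>r. \<forall>z. Re z < r \<longrightarrow> Fin z \<in> S \<inter> T" if "MInf \<in> S \<inter> T"
  proof -
    from S that obtain r where r: "\<And>z. Re z < r \<Longrightarrow> Fin z \<in> S"
      by (auto simp: open_excomplex_def)
    from T that obtain s where s: "\<And>z. Re z < s \<Longrightarrow> Fin z \<in> T"
      by (auto simp: open_excomplex_def)
    have "\<forall>z. Re z < min r s \<longrightarrow> Fin z \<in> S \<inter> T"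
      using r s by simp
    then show ?thesis by blast
  qed
  moreover have "open (Fin -` (S \<inter> T))"
    using S T by (auto simp: open_excomplex_def vimage_Int)
  ultimately show "open (S \<inter> T)"
    by (simp add: open_excomplex_def)
next
  fix K :: "excomplex set set"
  assume K: "\<forall>S\<in>K. open S"
  have "open (\<Union>S\<in>K. Fin -` S)"
    using K by (intro open_UN) (auto simp: open_excomplex_def)
  moreover have "\<exists>r. \<forall>z. Re z < r \<longrightarrow> Fin z \<in> \<Union>K" if "MInf \<in> \<Union>K"
    using K that unfolding open_excomplex_def by (meson UnionE UnionI)
  ultimately show "open (\<Union>K)"
    by (simp add: open_excomplex_def vimage_Union)
qed

end

definition at_minf :: "complex filter" where
  "at_minf = filtercomap Fin (at MInf)"

lemma at_minf_eq_Re: "at_minf = filtercomap Re at_bot"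
proof (rule filter_eqI)
  fix P :: "complex \<Rightarrow> bool"
  have "eventually P at_minf \<longleftrightarrow> (\<exists>r. \<forall>z. Re z < r \<longrightarrow> P z)"
  proof
    assume "eventually P at_minf"
    then obtain S where "open S" "MInf \<in> S" "\<And>z. Fin z \<in> S \<Longrightarrow> P z"
      unfolding at_minf_def eventually_filtercomap eventually_at_topological by blast
    then show "\<exists>r. \<forall>z. Re z < r \<longrightarrow> P z"
      unfolding open_excomplex_def by blast
  next
    assume "\<exists>r. \<forall>z. Re z < r \<longrightarrow> P z"
    then obtain r where r: "\<And>z. Re z < r \<Longrightarrow> P z" by blast
    let ?S = "insert MInf (Fin ` {z. Re z < r})"
    have "Fin -` ?S = {z. Re z < r}" by auto
    then have "open ?S"
      by (auto simp: open_excomplex_def open_halfspace_Re_lt)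
    moreover have "P z" if "Fin z \<in> ?S" for z using that r by auto
    ultimately show "eventually P at_minf"
      unfolding at_minf_def eventually_filtercomap eventually_at_topological
      by (intro exI[of _ "\<lambda>v. v \<in> ?S"]) blast
  qed
  also have "\<dots> \<longleftrightarrow> eventually P (filtercomap Re at_bot)"
    unfolding eventually_filtercomap_at_bot_dense by blast
  finally show "eventually P at_minf \<longleftrightarrow> eventually P (filtercomap Re at_bot)" .
qed

lemma at_minf_eq_exp: "at_minf = filtercomap exp (nhds 0)"
proof (rule filter_eqI)
  fix P :: "complex \<Rightarrow> bool"
  have "eventually P at_minf \<longleftrightarrow> (\<exists>r. \<forall>z. Re z < r \<longrightarrow> P z)"
    by (simp add: at_minf_eq_Re eventually_filtercomap_at_bot_dense)
  also have "\<dots> \<longleftrightarrow> (\<exists>d>0. \<forall>z. norm (exp z) < d \<longrightarrow> P z)"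
  proof
    assume "\<exists>r. \<forall>z. Re z < r \<longrightarrow> P z"
    then obtain r where "\<And>z. Re z < r \<Longrightarrow> P z" by blast
    then show "\<exists>d>0. \<forall>z. norm (exp z) < d \<longrightarrow> P z"
      by (intro exI[of _ "exp r"]) simp
  next
    assume "\<exists>d>0. \<forall>z. norm (exp z) < d \<longrightarrow> P z"
    then obtain d where d: "d > 0" "\<And>z. norm (exp z) < d \<Longrightarrow> P z" by blast
    have "P z" if "Re z < ln d" for z
      using d that exp_less_mono[OF that] by simp
    then show "\<exists>r. \<forall>z. Re z < r \<longrightarrow> P z" by blast
  qed
  also have "\<dots> \<longleftrightarrow> eventually P (filtercomap exp (nhds 0))"
  proof
    assume "\<exists>d>0. \<forall>z. norm (exp z) < d \<longrightarrow> P z"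
    then obtain d where d: "d > 0" "\<And>z. norm (exp z) < d \<Longrightarrow> P z" by blast
    have "eventually (\<lambda>w::complex. norm w < d) (nhds 0)"
      using d(1) by (auto simp: eventually_nhds_metric dist_norm)
    with d(2) show "eventually P (filtercomap exp (nhds 0))"
      unfolding eventually_filtercomap by blast
  next
    assume "eventually P (filtercomap exp (nhds 0))"
    then obtain Q where Q: "eventually Q (nhds (0::complex))" "\<And>z. Q (exp z) \<Longrightarrow> P z"
      unfolding eventually_filtercomap by blast
    from Q(1) obtain d where d: "d > 0" "\<And>w. dist w 0 < d \<Longrightarrow> Q w"
      unfolding eventually_nhds_metric by blast
    have "P z" if "norm (exp z) < d" for z
      using Q(2) d(2) that by (simp add: dist_norm)
    with d(1) show "\<exists>d>0. \<forall>z. norm (exp z) < d \<longrightarrow> P z" by blast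
  qed
  finally show "eventually P at_minf \<longleftrightarrow> eventually P (filtercomap exp (nhds 0))" .
qed

lemma tendsto_Fin_iff: "((\<lambda>x. Fin (g x)) \<longlongrightarrow> Fin D) F \<longleftrightarrow> (g \<longlongrightarrow> D) F"
proof
  assume L: "((\<lambda>x. Fin (g x)) \<longlongrightarrow> Fin D) F"
  show "(g \<longlongrightarrow> D) F"
  proof (rule topological_tendstoI)
    fix S assume S: "open S" "D \<in> S"
    have "Fin -` (Fin ` S) = S" by auto
    with S have "open (Fin ` S)" by (auto simp: open_excomplex_def)
    from topological_tendstoD[OF L this] S(2)
    show "eventually (\<lambda>x. g x \<in> S) F"
      by (auto elim!: eventually_mono)
  qed
next
  assume L: "(g \<longlongrightarrow> D) F"
  show "((\<lambda>x. Fin (g x)) \<longlongrightarrow> Fin D) F"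
  proof (rule topological_tendstoI)
    fix S assume "open S" "Fin D \<in> S"
    then have "open (Fin -` S)" "D \<in> Fin -` S" by (auto simp: open_excomplex_def)
    from topological_tendstoD[OF L this] show "eventually (\<lambda>x. Fin (g x) \<in> S) F" by simp
  qed
qed

text \<open>A multivalued expression is the set of all its values, so an equation modulo
  \<open>2 \<pi> i\<close> between such expressions is an equation between sets.\<close>

definition mlog :: "complex \<Rightarrow> excomplex set" where
  "mlog w = (if w = 0 then {MInf}
             else {Fin (of_real (ln (cmod w)) + \<i> * of_real t) | t. is_Arg w t})"

lemma mlog_eq: "mlog w = {v. eexp v = w}"
proof (cases "w = 0")
  case True
  have "eexp v = 0 \<longleftrightarrow> v = MInf" for v by (cases v) auto
  with True show ?thesis by (auto simp: mlog_def)
next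
  case False
  have "v \<in> mlog w \<longleftrightarrow> eexp v = w" for v
  proof (cases v)
    case MInf
    with False show ?thesis by (auto simp: mlog_def)
  next
    case (Fin z)
    have "v \<in> mlog w \<longleftrightarrow> Re z = ln (cmod w) \<and> is_Arg w (Im z)"
      using False Fin by (auto simp: mlog_def complex_eq_iff)
    also have "\<dots> \<longleftrightarrow> exp z = w"
    proof
      assume *: "Re z = ln (cmod w) \<and> is_Arg w (Im z)"
      have "exp z = of_real (exp (Re z)) * exp (\<i> * of_real (Im z))"
        by (metis complex_eq exp_add exp_of_real)
      with * False show "exp z = w" by (simp add: is_Arg_def)
    next
      assume *: "exp z = w"
      have "exp z = of_real (exp (Re z)) * exp (\<i> * of_real (Im z))"
        by (metis complex_eq exp_add exp_of_real)
      moreover have "cmod w = exp (Re z)" using * by auto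
      ultimately show "Re z = ln (cmod w) \<and> is_Arg w (Im z)"
        using * by (simp add: is_Arg_def)
    qed
    finally show ?thesis using Fin by simp
  qed
  then show ?thesis by blast
qed

definition cjoin :: "excomplex \<Rightarrow> excomplex \<Rightarrow> excomplex set"  (infixl \<open>\<or>\<^sub>c\<close> 65) where
  "v \<or>\<^sub>c w = mlog (eexp v + eexp w)"

text \<open>\<open>D\<close> is a value of the limit of \<open>[f (z \<or> h) \<or> (f z + i \<pi>)] - h\<close> as \<open>h\<close> tends to \<open>-\<infinity>\<close>.
  Here \<open>p h\<close> and \<open>l h\<close> are the values of the inner and the outer join. Since \<open>f\<close> need not be
  \<open>2 \<pi> i\<close>-periodic, \<open>f (z \<or> h)\<close> makes sense only for a particular branch of \<open>z \<or> h\<close>: it is the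
  one tending to \<open>z = z \<or> -\<infinity>\<close>. The branch of the outer join is free, so the limit
  is taken, and determined, modulo \<open>2 \<pi> i\<close>. That it is finite is expressed by the type of \<open>D\<close>.\<close>

definition has_vderiv :: "complex set \<Rightarrow> (complex \<Rightarrow> excomplex) \<Rightarrow> complex \<Rightarrow> complex \<Rightarrow> bool" where
  "has_vderiv G f z D \<longleftrightarrow>
     (\<exists>p l. (\<forall>\<^sub>F h in at_minf. Fin (p h) \<in> Fin z \<or>\<^sub>c Fin h \<and> p h \<in> G) \<and>
            (p \<longlongrightarrow> z) at_minf \<and>
            (\<forall>\<^sub>F h in at_minf. l h \<in> f (p h) \<or>\<^sub>c (f z \<oplus>\<^sub>e \<i> * of_real pi)) \<and>
            ((\<lambda>h. l h \<oplus>\<^sub>e - h) \<longlongrightarrow> Fin D) at_minf)"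

definition vdifferentiable_on :: "(complex \<Rightarrow> excomplex) \<Rightarrow> complex set \<Rightarrow> bool"
    (infix \<open>vdifferentiable'_on\<close> 50) where
  "f vdifferentiable_on G \<longleftrightarrow> (\<forall>z\<in>G. \<exists>D. has_vderiv G f z D)"

definition vderiv :: "complex set \<Rightarrow> (complex \<Rightarrow> excomplex) \<Rightarrow> complex \<Rightarrow> excomplex set" where
  "vderiv G f z = {Fin D | D. has_vderiv G f z D}"

end

(* Exponentiating removes the branches: with exp (p h) = exp z + exp h, the exponential of the
   expression under the limit is the quotient
     (exp (f (p h)) - exp (f z)) / (exp (p h) - exp z),
   and p h tends to z without attaining it, so exp D = exp (f z) f'(z) / exp z. Conversely, any two
   D with the same exponential differ by a period of exp, which can be absorbed into the branch
   of the outer join. In particular f' does not vanish where the derivative exists. *)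

theory Submission
  imports Defs
begin

text \<open>Needed for limits along \<open>at_minf\<close> to be unique: every left half-plane
  contains a point.\<close>

lemma at_minf_neq_bot: "at_minf \<noteq> bot"
proof
  assume "at_minf = bot"
  then have "eventually (\<lambda>_. False) (filtercomap Re at_bot)"
    by (simp flip: at_minf_eq_Re)
  then obtain r where "\<And>z. \<not> Re z < r"
    unfolding eventually_filtercomap_at_bot_dense by blast
  from this[of "complex_of_real (r - 1)"] show False by simp
qed

text \<open>The finite points form an open set, so convergence to a finite limit forces finite
  values eventually. This reduces limits in \<open>excomplex\<close> to limits in the complex
  plane.\<close>

lemma tendsto_FinE:
  assumes "(k \<longlongrightarrow> Fin D) F"
  obtains g where "\<forall>\<^sub>F x in F. k x = Fin (g x)" "(g \<longlongrightarrow> D) F"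
proof -
  \<comment> \<open>The value 0 at \<open>MInf\<close> is arbitrary, since only eventual values
    matter.\<close>
  define g where "g x = (case k x of Fin w \<Rightarrow> w | MInf \<Rightarrow> 0)" for x
  have "open (range Fin)"
    by (auto simp: open_excomplex_def vimage_def)
  from topological_tendstoD[OF assms this]
  have ev: "\<forall>\<^sub>F x in F. k x = Fin (g x)"
    by (auto simp: g_def elim!: eventually_mono)
  from Lim_transform_eventually[OF assms this]
  have "((\<lambda>x. Fin (g x)) \<longlongrightarrow> Fin D) F" .
  then show thesis
    using that ev by (simp add: tendsto_Fin_iff)
qed

lemma tendsto_eexp:
  assumes "(k \<longlongrightarrow> Fin D) F"
  shows "((\<lambda>x. eexp (k x)) \<longlongrightarrow> exp D) F"
proof -
  obtain g where g: "\<forall>\<^sub>F x in F. k x = Fin (g x)" "(g \<longlongrightarrow> D) F"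
    using tendsto_FinE[OF assms] .
  from g(1) have "\<forall>\<^sub>F x in F. exp (g x) = eexp (k x)"
    by (rule eventually_mono) simp
  from Lim_transform_eventually[OF tendsto_exp[OF g(2)] this] show ?thesis .
qed

lemma tendsto_shift:
  assumes "(k \<longlongrightarrow> Fin D) F"
  shows "((\<lambda>x. k x \<oplus>\<^sub>e c) \<longlongrightarrow> Fin (D + c)) F"
proof -
  obtain g where g: "\<forall>\<^sub>F x in F. k x = Fin (g x)" "(g \<longlongrightarrow> D) F"
    using tendsto_FinE[OF assms] .
  have "((\<lambda>x. Fin (g x + c)) \<longlongrightarrow> Fin (D + c)) F"
    unfolding tendsto_Fin_iff by (intro tendsto_intros g(2))
  moreover from g(1) have "\<forall>\<^sub>F x in F. Fin (g x + c) = k x \<oplus>\<^sub>e c"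
    by (rule eventually_mono) simp
  ultimately show ?thesis
    by (rule Lim_transform_eventually)
qed

lemma eexp_shift: "eexp (v \<oplus>\<^sub>e w) = eexp v * exp w"
  by (cases v) (auto simp: exp_add)

lemma shift_shift: "v \<oplus>\<^sub>e w \<oplus>\<^sub>e u = v \<oplus>\<^sub>e (w + u)"
  by (cases v) (auto simp: add.assoc)

text \<open>Turns a choice of branch into a single exponential equation, so that no argument has to
  be tracked.\<close>

lemma in_cjoin_iff: "u \<in> v \<or>\<^sub>c w \<longleftrightarrow> eexp u = eexp v + eexp w"
  by (simp add: cjoin_def mlog_eq)

text \<open>Divide the difference quotient of \<open>exp (f w)\<close> by that of
  \<open>exp w\<close>; the latter tends to \<open>exp z\<close>, which is nonzero.\<close>

lemma tendsto_exp_quotient: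
  fixes f :: "complex \<Rightarrow> complex"
  assumes "(f has_field_derivative f') (at z)"
  shows "((\<lambda>w. (exp (f w) - exp (f z)) / (exp w - exp z)) \<longlongrightarrow> f' * exp (f z) / exp z) (at z)"
proof -
  have 1: "((\<lambda>w. exp (f w)) has_field_derivative (exp (f z) * f')) (at z)"
    using assms by (auto intro!: derivative_eq_intros)
  have 2: "(exp has_field_derivative exp z) (at z)"
    by (rule DERIV_exp)
  have "((\<lambda>w. ((exp (f w) - exp (f z)) / (w - z)) / ((exp w - exp z) / (w - z)))
      \<longlongrightarrow> exp (f z) * f' / exp z) (at z)"
    using 1 2 unfolding has_field_derivative_iff by (intro tendsto_divide) auto
  \<comment> \<open>For \<open>w\<close> distinct from \<open>z\<close> the factor
    \<open>w - z\<close> cancels. If \<open>exp w = exp z\<close>, both sides are 0 because division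
    by zero yields 0.\<close>
  moreover have "\<forall>\<^sub>F w in at z. ((exp (f w) - exp (f z)) / (w - z)) / ((exp w - exp z) / (w - z))
      = (exp (f w) - exp (f z)) / (exp w - exp z)"
    by (auto simp: eventually_at_filter)
  ultimately show ?thesis
    by (subst mult.commute) (rule Lim_transform_eventually)
qed

lemma has_vderiv_exp_eq:
  assumes f: "(f has_field_derivative f') (at z)"
    and D: "has_vderiv G (\<lambda>w. Fin (f w)) z D"
  shows "exp D = f' * exp (f z) / exp z"
proof -
  obtain p l where p: "\<forall>\<^sub>F h in at_minf. Fin (p h) \<in> Fin z \<or>\<^sub>c Fin h \<and> p h \<in> G"
      "(p \<longlongrightarrow> z) at_minf"
    and l: "\<forall>\<^sub>F h in at_minf. l h \<in> Fin (f (p h)) \<or>\<^sub>c (Fin (f z) \<oplus>\<^sub>e \<i> * of_real pi)"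
      "((\<lambda>h. l h \<oplus>\<^sub>e - h) \<longlongrightarrow> Fin D) at_minf"
    using D unfolding has_vderiv_def by blast
  have exp_p: "\<forall>\<^sub>F h in at_minf. exp (p h) = exp z + exp h"
    using p(1) by (rule eventually_mono) (simp add: in_cjoin_iff)
  \<comment> \<open>If \<open>p h = z\<close>, then \<open>exp h\<close> would be 0.\<close>
  then have "\<forall>\<^sub>F h in at_minf. p h \<noteq> z"
    by (rule eventually_mono) auto
  with p(2) have "filterlim p (at z) at_minf"
    by (simp add: filterlim_at)
  then have lim: "((\<lambda>h. (exp (f (p h)) - exp (f z)) / (exp (p h) - exp z))
      \<longlongrightarrow> f' * exp (f z) / exp z) at_minf"
    by (rule filterlim_compose[OF tendsto_exp_quotient[OF f]])
  \<comment> \<open>Adding i pi negates \<open>exp (f z)\<close>, so the outer join becomes a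
    difference; the shift by \<open>- h\<close> divides by \<open>exp h\<close>, which is
    \<open>exp (p h) - exp z\<close>.\<close>
  have "\<forall>\<^sub>F h in at_minf. eexp (l h \<oplus>\<^sub>e - h)
      = (exp (f (p h)) - exp (f z)) / (exp (p h) - exp z)"
    using exp_p l(1) by eventually_elim
      (simp add: in_cjoin_iff eexp_shift exp_minus exp_add divide_inverse)
  with tendsto_eexp[OF l(2)]
  have "((\<lambda>h. (exp (f (p h)) - exp (f z)) / (exp (p h) - exp z)) \<longlongrightarrow> exp D) at_minf"
    by (rule Lim_transform_eventually)
  from tendsto_unique[OF at_minf_neq_bot this lim] show ?thesis .
qed

text \<open>Keep the inner branch \<open>p\<close> and shift the outer branch \<open>l\<close> by
  \<open>c\<close>: its exponential is unchanged, so it still takes values in the outer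
  join.\<close>

lemma has_vderiv_add_period:
  assumes "has_vderiv G f z D" and c: "exp c = 1"
  shows "has_vderiv G f z (D + c)"
proof -
  obtain p l where p: "\<forall>\<^sub>F h in at_minf. Fin (p h) \<in> Fin z \<or>\<^sub>c Fin h \<and> p h \<in> G"
      "(p \<longlongrightarrow> z) at_minf"
    and l: "\<forall>\<^sub>F h in at_minf. l h \<in> f (p h) \<or>\<^sub>c (f z \<oplus>\<^sub>e \<i> * of_real pi)"
      "((\<lambda>h. l h \<oplus>\<^sub>e - h) \<longlongrightarrow> Fin D) at_minf"
    using assms(1) unfolding has_vderiv_def by blast
  have "((\<lambda>h. l h \<oplus>\<^sub>e c \<oplus>\<^sub>e - h) \<longlongrightarrow> Fin (D + c)) at_minf"
    using tendsto_shift[OF l(2), of c] by (simp add: shift_shift add.commute)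
  moreover have "\<forall>\<^sub>F h in at_minf. l h \<oplus>\<^sub>e c \<in> f (p h) \<or>\<^sub>c (f z \<oplus>\<^sub>e \<i> * of_real pi)"
    using l(1) by (rule eventually_mono) (simp add: in_cjoin_iff eexp_shift c)
  ultimately show ?thesis
    unfolding has_vderiv_def using p
    by (intro exI[of _ p] exI[of _ "\<lambda>h. l h \<oplus>\<^sub>e c"]) blast
qed

theorem theorem5p6:
  fixes f :: "complex \<Rightarrow> complex" and G :: "complex set"
  assumes "open G"
    and "f analytic_on G"
    and "(\<lambda>w. Fin (f w)) vdifferentiable_on G"
  shows "\<forall>z\<in>G. vderiv G (\<lambda>w. Fin (f w)) z = {l \<oplus>\<^sub>e f z \<oplus>\<^sub>e - z | l. l \<in> mlog (deriv f z)}"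
proof
  fix z assume z: "z \<in> G"
  let ?F = "\<lambda>w. Fin (f w)"
  have f: "(f has_field_derivative deriv f z) (at z)"
    using assms(2) z analytic_on_imp_differentiable_at DERIV_deriv_iff_field_differentiable by blast
  obtain D0 where D0: "has_vderiv G ?F z D0"
    using assms(3) z unfolding vdifferentiable_on_def by blast
  note exp_D0 = has_vderiv_exp_eq[OF f D0]
  \<comment> \<open>The converse starts from the value \<open>D0\<close> supplied by
    differentiability: any other solution \<open>D\<close> differs from it by a period of
    \<open>exp\<close>.\<close>
  have iff: "has_vderiv G ?F z D \<longleftrightarrow> exp D = deriv f z * exp (f z) / exp z" for D
  proof
    assume "exp D = deriv f z * exp (f z) / exp z"
    then have "exp (D - D0) = 1"
      by (simp add: exp_diff flip: exp_D0)
    from has_vderiv_add_period[OF D0 this] show "has_vderiv G ?F z D"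
      by simp
  qed (rule has_vderiv_exp_eq[OF f])
  \<comment> \<open>The exponential of \<open>D0\<close> is nonzero, so no factor on the right of
    \<open>exp_D0\<close> vanishes. Hence \<open>MInf\<close> is not a value of the logarithm of the
    derivative.\<close>
  have nz: "deriv f z \<noteq> 0"
    using exp_D0 by auto
  have "v \<in> vderiv G ?F z \<longleftrightarrow> (\<exists>l. v = l \<oplus>\<^sub>e f z \<oplus>\<^sub>e - z \<and> l \<in> mlog (deriv f z))" for v
  proof
    assume "v \<in> vderiv G ?F z"
    then obtain D where D: "v = Fin D" "exp D = deriv f z * exp (f z) / exp z"
      by (auto simp: vderiv_def iff)
    \<comment> \<open>The witness undoes the shifts by \<open>f z\<close> and
      \<open>- z\<close>.\<close>
    then have "Fin (D - f z + z) \<in> mlog (deriv f z)"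
      by (simp add: mlog_eq exp_add exp_diff)
    with D(1) show "\<exists>l. v = l \<oplus>\<^sub>e f z \<oplus>\<^sub>e - z \<and> l \<in> mlog (deriv f z)"
      by (intro exI[of _ "Fin (D - f z + z)"]) simp
  next
    assume "\<exists>l. v = l \<oplus>\<^sub>e f z \<oplus>\<^sub>e - z \<and> l \<in> mlog (deriv f z)"
    then obtain l where l: "v = l \<oplus>\<^sub>e f z \<oplus>\<^sub>e - z" "eexp l = deriv f z"
      by (auto simp: mlog_eq)
    with nz obtain L where "l = Fin L" by (cases l) auto
    with l show "v \<in> vderiv G ?F z"
      by (simp add: vderiv_def iff exp_add exp_diff)
  qed
  then show "vderiv G ?F z = {l \<oplus>\<^sub>e f z \<oplus>\<^sub>e - z | l. l \<in> mlog (deriv f z)}"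
    by blast
qed

end
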